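(* Let $F$ be a field of characteristic different from $2$, let $V$ be a vector space over $F$, let $f\colon V\times V\to F$ be a symmetric bilinear form (possibly degenerate), and let $J=F\cdot 1\oplus V$ be the (not necessarily simple) Jordan algebra of the bilinear form $f$. Then $\mathrm{rb}(J)\le 3$; that is, every Rota--Baxter operator $R$ of weight zero on $J$ satisfies $R^3=0$.
   Context: The Jordan algebra of a symmetric bilinear form $f$ on a vector space $V$ is the space $F\cdot1\oplus V$ with product $(\alpha\cdot1+v)(\beta\cdot1+u)=(\alpha\beta+f(v,u))\cdot1+(\alpha u+\beta v)$ for $\alpha,\beta\in F$, $u,v\in V$. A Rota--Baxter operator of weight zero on an algebra $A$ over $F$ is a linear map $R\colon A\to A$ such that $R(x)R(y)=R(R(x)y+xR(y))$ for all $x,y\in A$. $\mathrm{rb}(J)$ denotes the minimal natural number $s\geq 1$ such that $R^s=0$ for every Rota--Baxter operator $R$ of weight zero on $J$. *)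

theory Defs
  imports "HOL-Analysis.Product_Vector" "HOL-Library.Extended_Nat"
begin

definition symmetric_bilinear_form ::
    "('a::field \<Rightarrow> 'v::ab_group_add \<Rightarrow> 'v) \<Rightarrow> ('v \<Rightarrow> 'v \<Rightarrow> 'a) \<Rightarrow> bool" where
  "symmetric_bilinear_form s f \<longleftrightarrow>
     (\<forall>v. Vector_Spaces.linear s (*) (\<lambda>u. f v u)) \<and>
     (\<forall>u. Vector_Spaces.linear s (*) (\<lambda>v. f v u)) \<and>
     (\<forall>v u. f v u = f u v)"

text \<open>
  The pair \<open>(\<alpha>, v)\<close> stands for the element \<open>\<alpha> \<cdot> 1 + v\<close> of \<open>F \<cdot> 1 \<oplus> V\<close>. Addition on pairs is
  componentwise, and scalar multiplication is that of the product vector space.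
\<close>

abbreviation bf_scale ::
    "('a::field \<Rightarrow> 'v::ab_group_add \<Rightarrow> 'v) \<Rightarrow> 'a \<Rightarrow> 'a \<times> 'v \<Rightarrow> 'a \<times> 'v" where
  "bf_scale s \<equiv> module_prod.scale (*) s"

fun bf_mult ::
    "('a::field \<Rightarrow> 'v::ab_group_add \<Rightarrow> 'v) \<Rightarrow> ('v \<Rightarrow> 'v \<Rightarrow> 'a) \<Rightarrow> 'a \<times> 'v \<Rightarrow> 'a \<times> 'v \<Rightarrow> 'a \<times> 'v" where
  "bf_mult s f (\<alpha>, v) (\<beta>, u) = (\<alpha> * \<beta> + f v u, s \<alpha> u + s \<beta> v)"

text \<open>
  An algebra over a field is given here by its scalar multiplication \<open>s\<close> and its product \<open>m\<close>.
\<close>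

definition rota_baxter_zero ::
    "('a::field \<Rightarrow> 'b::ab_group_add \<Rightarrow> 'b) \<Rightarrow> ('b \<Rightarrow> 'b \<Rightarrow> 'b) \<Rightarrow> ('b \<Rightarrow> 'b) \<Rightarrow> bool" where
  "rota_baxter_zero s m R \<longleftrightarrow>
     Vector_Spaces.linear s s R \<and>
     (\<forall>x y. m (R x) (R y) = R (m (R x) y + m x (R y)))"

text \<open>
  The infimum is taken in the extended naturals, so the value is \<open>\<infinity>\<close>
  if no power annihilates all operators, and the minimal such exponent otherwise.
\<close>

definition rb ::
    "('a::field \<Rightarrow> 'b::ab_group_add \<Rightarrow> 'b) \<Rightarrow> ('b \<Rightarrow> 'b \<Rightarrow> 'b) \<Rightarrow> enat" where
  "rb s m = Inf {enat n | n. 1 \<le> n \<and> (\<forall>R. rota_baxter_zero s m R \<longrightarrow> R ^^ n = (\<lambda>_. 0))}"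

lemma vector_space_bf_scale:
  assumes "vector_space s"
  shows "vector_space (bf_scale s)"
proof -
  interpret vector_space s by fact
  interpret F: vector_space "(*) :: 'a \<Rightarrow> 'a \<Rightarrow> 'a"
    by unfold_locales (simp_all add: algebra_simps)
  interpret vector_space_prod "(*) :: 'a \<Rightarrow> 'a \<Rightarrow> 'a" s
    by unfold_locales
  show ?thesis by (rule p.vector_space_axioms)
qed

lemma bf_scale_Pair:
  assumes "vector_space s"
  shows "bf_scale s c (\<alpha>, v) = (c * \<alpha>, s c v)"
proof -
  interpret vector_space s by fact
  interpret F: vector_space "(*) :: 'a \<Rightarrow> 'a \<Rightarrow> 'a"
    by unfold_locales (simp_all add: algebra_simps)
  interpret vector_space_prod "(*) :: 'a \<Rightarrow> 'a \<Rightarrow> 'a" s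
    by unfold_locales
  show ?thesis by (rule scale_prod)
qed

lemma bf_mult_commute:
  assumes "symmetric_bilinear_form s f"
  shows "bf_mult s f x y = bf_mult s f y x"
  using assms
  by (cases x; cases y) (auto simp: symmetric_bilinear_form_def algebra_simps)

lemma bf_mult_one:
  assumes "vector_space s" and "symmetric_bilinear_form s f"
  shows "bf_mult s f (1, 0) x = x"
proof -
  interpret vector_space s by fact
  have "f 0 u = 0" for u
    using assms(2) unfolding symmetric_bilinear_form_def
    by (auto simp flip: module_hom_iff_linear dest: module_hom.zero)
  then show ?thesis by (cases x) simp
qed

lemma bf_mult_jordan:
  assumes "vector_space s" and "symmetric_bilinear_form s f"
  shows "bf_mult s f (bf_mult s f x y) (bf_mult s f x x) =
         bf_mult s f x (bf_mult s f y (bf_mult s f x x))"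
proof -
  interpret vector_space s by fact
  have sym: "f u v = f v u" for u v
    using assms(2) by (simp add: symmetric_bilinear_form_def)
  have hom: "module_hom s (*) (f v)" for v
    using assms(2) by (simp add: symmetric_bilinear_form_def module_hom_iff_linear)
  have [simp]: "f v (u + w) = f v u + f v w" "f v (s c u) = c * f v u" for u v w c
    using module_hom.add[OF hom] module_hom.scale[OF hom] by auto
  have [simp]: "f (u + w) v = f u v + f w v" "f (s c u) v = c * f u v" for u v w c
    by (simp_all add: sym[of _ v])
  have [simp]: "s (a * (2 * b)) u = s (a * b) u + s (a * b) u" for a b u
    by (simp flip: scale_left_distrib add: mult.left_commute)
  show ?thesis
    by (cases x; cases y) (simp add: sym algebra_simps)
qed

end

theory Submission
  imports Defs
begin

text \<open>
  For \<open>x\<close> and \<open>y\<close> with vector parts \<open>v\<close> and \<open>u\<close>, write \<open>\<lambda>(x)\<close> for the scalar part of \<open>x\<close> and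
  \<open>n(x, y) = \<lambda>(x) \<lambda>(y) - f(v, u)\<close> for the bilinear form of the norm. The algebra has degree two, in the sense that
  \<open>x y = \<lambda>(x) y + \<lambda>(y) x - n(x, y) 1\<close>.

  The image of a Rota--Baxter operator \<open>R\<close> is a subalgebra, and it does not contain \<open>1\<close>: if
  \<open>R(x) = 1\<close>, then \<open>1 = R(x) R(x) = R(x + x) = 1 + 1\<close>. The degree-two identity for two elements
  of the image therefore forces \<open>n\<close> to vanish on the image. This makes the left-hand side of the
  Rota--Baxter identity equal to \<open>R(\<lambda>(R x) y + \<lambda>(R y) x)\<close>. Expanding the right-hand side by the
  degree-two identity too, the terms of this shape cancel, and what remains is the key relation
  (lemma \<open>square_relation\<close>), in which \<open>e = R(1)\<close>:
  \<open>\<lambda>(y) R\<^sup>2(x) + \<lambda>(x) R\<^sup>2(y) = (n(R x, y) + n(x, R y)) e\<close>.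

  Putting \<open>y = 1\<close> shows that \<open>R\<^sup>2\<close> takes its values in the line spanned by \<open>e\<close>, and putting
  \<open>x = y = 1\<close> and dividing by two shows that \<open>R(e) = c e\<close> with \<open>c = \<lambda>(e)\<close>. At \<open>x = y = e\<close>
  the right-hand side vanishes, because \<open>e\<close> and \<open>R(e)\<close> lie in the image, and the relation
  reads \<open>2 c\<^sup>3 e = 0\<close>. Hence \<open>R(e) = c e = 0\<close>, and so \<open>R\<^sup>3 = 0\<close>.
\<close>

locale rota_baxter_bilinear_form = vector_space s
  for s :: "'a::field \<Rightarrow> 'v::ab_group_add \<Rightarrow> 'v" +
  fixes f :: "'v \<Rightarrow> 'v \<Rightarrow> 'a"
    and R :: "'a \<times> 'v \<Rightarrow> 'a \<times> 'v"
  assumes form: "symmetric_bilinear_form s f"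
    and rota_baxter: "rota_baxter_zero (bf_scale s) (bf_mult s f) R"
begin

abbreviation scaleJ (infixr "\<star>" 75) where "c \<star> x \<equiv> bf_scale s c x"

abbreviation multJ (infixl "\<bullet>" 70) where "x \<bullet> y \<equiv> bf_mult s f x y"

abbreviation oneJ ("\<one>") where "\<one> \<equiv> (1, 0)"

definition norm_form :: "'a \<times> 'v \<Rightarrow> 'a \<times> 'v \<Rightarrow> 'a" where
  "norm_form x y = fst x * fst y - f (snd x) (snd y)"

sublocale J: vector_space "bf_scale s"
  by (rule vector_space_bf_scale) (rule vector_space_axioms)

sublocale R: Vector_Spaces.linear "bf_scale s" "bf_scale s" R
  using rota_baxter by (simp add: rota_baxter_zero_def)

lemma RB: "R x \<bullet> R y = R (R x \<bullet> y + x \<bullet> R y)"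
  using rota_baxter unfolding rota_baxter_zero_def by blast

lemma mult_one [simp]: "\<one> \<bullet> x = x" "x \<bullet> \<one> = x"
  using bf_mult_one[OF vector_space_axioms form] bf_mult_commute[OF form] by metis+

lemma form_zero_right [simp]: "f v 0 = 0"
proof -
  have "module_hom s (*) (f v)"
    using form by (simp add: symmetric_bilinear_form_def module_hom_iff_linear)
  then show ?thesis by (rule module_hom.zero)
qed

lemma form_zero_left [simp]: "f 0 v = 0"
  using form form_zero_right[of v] by (simp add: symmetric_bilinear_form_def)

lemma norm_form_one [simp]: "norm_form \<one> x = fst x" "norm_form x \<one> = fst x"
  by (simp_all add: norm_form_def)

lemma degree_two_identity:
  "x \<bullet> y = fst x \<star> y + fst y \<star> x - norm_form x y \<star> \<one>"
  by (cases x; cases y)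
    (simp add: norm_form_def bf_scale_Pair[OF vector_space_axioms] algebra_simps)

lemma one_not_in_range: "R x \<noteq> \<one>"
proof
  assume "R x = \<one>"
  then have "\<one> = \<one> + (\<one> :: 'a \<times> 'v)"
    using RB[of x x] by (simp add: R.add del: bf_mult.simps add_Pair)
  then show False
    by (metis add_cancel_right_right one_neq_zero prod.inject zero_prod_def)
qed

text \<open>
  By the degree-two identity, \<open>n(R x, R y) 1\<close> is a combination of \<open>R(x)\<close>, \<open>R(y)\<close> and
  \<open>R(x) R(y)\<close>, all of which lie in the image.
\<close>

lemma norm_form_range [simp]: "norm_form (R x) (R y) = 0"
proof (rule ccontr)
  let ?n = "norm_form (R x) (R y)"
  let ?w = "fst (R x) \<star> y + fst (R y) \<star> x - (R x \<bullet> y + x \<bullet> R y)"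
  assume "?n \<noteq> 0"
  have "R ?w = ?n \<star> \<one>"
    by (simp add: R.diff R.add[of "_ \<star> _"] R.scale degree_two_identity[of "R x" "R y"] flip: RB)
  then have "R ((1 / ?n) \<star> ?w) = \<one>"
    using \<open>?n \<noteq> 0\<close> by (simp only: R.scale J.scale_scale) (simp del: bf_mult.simps)
  then show False
    using one_not_in_range by blast
qed

text \<open>
  Since \<open>n\<close> vanishes on the image, both sides of the Rota--Baxter identity contain
  \<open>\<lambda>(R x) R(y) + \<lambda>(R y) R(x)\<close>, which cancels. No product of the algebra remains: this is a linear constraint on \<open>R\<^sup>2\<close>.
\<close>

lemma square_relation:
  "fst y \<star> R (R x) + fst x \<star> R (R y) = (norm_form (R x) y + norm_form x (R y)) \<star> R \<one>"
proof -
  have "fst (R x) \<star> R y + fst (R y) \<star> R x = R x \<bullet> R y"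
    by (simp add: degree_two_identity[of "R x" "R y"])
  also have "\<dots> = R (R x \<bullet> y + x \<bullet> R y)"
    by (rule RB)
  also have "\<dots> = fst (R x) \<star> R y + fst y \<star> R (R x) - norm_form (R x) y \<star> R \<one>
      + (fst x \<star> R (R y) + fst (R y) \<star> R x - norm_form x (R y) \<star> R \<one>)"
    by (simp add: degree_two_identity[of "R x" y] degree_two_identity[of x "R y"]
        R.add R.diff R.scale)
  finally show ?thesis
    by (simp add: algebra_simps)
qed

context
  assumes two_nonzero: "(2 :: 'a) \<noteq> 0"
begin

lemma R_R_one: "R (R \<one>) = fst (R \<one>) \<star> R \<one>"
proof -
  have "2 \<star> R (R \<one>) = 2 \<star> fst (R \<one>) \<star> R \<one>"
    using square_relation[of \<one> \<one>] J.scale_left_distrib[of 1 1 "R (R \<one>)"] by simp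
  then show ?thesis
    using two_nonzero by (simp only: J.scale_cancel_left) simp
qed

lemma R_R_one_eq_zero: "R (R \<one>) = 0"
proof -
  define e where "e = R \<one>"
  define c where "c = fst e"
  have Re: "R e = c \<star> e"
    unfolding e_def c_def by (rule R_R_one)
  \<comment> \<open>Both \<open>e\<close> and \<open>R e\<close> lie in the image, so the right-hand side of the key relation vanishes.\<close>
  have "c \<star> R (R e) + c \<star> R (R e) = 0"
    using square_relation[of e e] by (simp add: e_def c_def)
  then have "(2 * (c * c * c)) \<star> e = 0"
    using J.scale_left_distrib[of "c * c * c" "c * c * c" e]
    by (simp add: Re R.scale mult.assoc)
  then have "c = 0 \<or> e = 0"
    using two_nonzero by simp
  then show ?thesis
    using Re by (auto simp: e_def)
qed

lemma cube_eq_zero: "R ^^ 3 = (\<lambda>_. 0)"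
proof
  fix x
  have "R (R x) = (fst (R x) + norm_form x (R \<one>)) \<star> R \<one>"
    using square_relation[of \<one> x] by (simp add: R_R_one_eq_zero)
  then have "R (R (R x)) = 0"
    by (simp add: R.scale R_R_one_eq_zero)
  then show "(R ^^ 3) x = 0"
    by (simp add: eval_nat_numeral)
qed

end

end

theorem theorem1:
  fixes s :: "'a::field \<Rightarrow> 'v::ab_group_add \<Rightarrow> 'v"
    and f :: "'v \<Rightarrow> 'v \<Rightarrow> 'a"
  assumes "CHAR('a) \<noteq> 2"
    and "vector_space s"
    and "symmetric_bilinear_form s f"
  shows "rb (bf_scale s) (bf_mult s f) \<le> 3 \<and>
         (\<forall>R. rota_baxter_zero (bf_scale s) (bf_mult s f) R \<longrightarrow> R ^^ 3 = (\<lambda>_. 0))"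
proof -
  have "\<not> CHAR('a) dvd 2"
  proof
    assume "CHAR('a) dvd 2"
    then have "CHAR('a) \<le> 2" and "CHAR('a) \<noteq> 0"
      by (rule dvd_imp_le, simp) (metis \<open>CHAR('a) dvd 2\<close> dvd_0_left_iff zero_neq_numeral)
    then show False
      using assms(1) CHAR_not_1'[where 'a = 'a] by linarith
  qed
  then have two: "(2 :: 'a) \<noteq> 0"
    using of_nat_eq_0_iff_char_dvd[of 2, where 'a = 'a] by simp
  have cube: "R ^^ 3 = (\<lambda>_. 0)"
    if "rota_baxter_zero (bf_scale s) (bf_mult s f) R" for R
  proof -
    interpret vector_space s by fact
    interpret rota_baxter_bilinear_form s f R
      using assms(3) that by unfold_locales
    show ?thesis using two by (rule cube_eq_zero)
  qed
  moreover have "rb (bf_scale s) (bf_mult s f) \<le> enat 3"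
    unfolding rb_def using cube by (intro Inf_lower) auto
  ultimately show ?thesis
    by (simp add: numeral_eq_enat)
qed

end
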